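(* Let $G$ be a standard reductive group over $\Bbbk$ with Lie algebra $\mathfrak g$, and let $m>0$. The nilpotent elements of $\mathfrak g_m$ are precisely those of the form $$x_0+\sum_{i=1}^m x_it^i$$ where $x_0\in\mathfrak g$ is nilpotent and $x_1,\dots,x_m\in\mathfrak g$ are arbitrary.
   Context: $\Bbbk$ is an algebraically closed field of characteristic $p>0$. A standard reductive group $G$ is a connected reductive algebraic group over $\Bbbk$ such that (H1) the derived subgroup of $G$ is simply connected, (H2) $p$ is good for the root system of $G$, (H3) there is a non-degenerate $G$-invariant bilinear form $\kappa$ on $\mathfrak g=\operatorname{Lie}(G)$. The truncated current algebra $\mathfrak g_m=\mathfrak g\otimes\Bbbk[t]/(t^{m+1})$ is a Lie algebra over $\Bbbk$ with bracket $[xt^i,yt^j]=[x,y]t^{i+j}$ where $xt^i:=x\otimes t^i$; it is restricted, with $p$-map determined by $(xt^i)^{[p]}=x^{[p]}t^{pi}$. An element $x$ of a restricted Lie algebra is nilpotent if $x^{[p]^i}=0$ for $i\gg0$. *)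

theory Defs
  imports
    "Jordan_Normal_Form.VS_Connect"
    "Jordan_Normal_Form.Determinant"
    "HOL-Algebra.Generated_Groups"
    "HOL-Library.Poly_Mapping"
begin

section \<open>Restricted Lie algebras\<close>

text \<open>As in \<open>HOL-Algebra.Module\<close>, the fields \<open>mult\<close> and \<open>one\<close> inherited from the ring record
  carry no meaning.\<close>

record ('k, 'v) lie_alg = "('k, 'v) module" +
  lie_bracket :: "'v \<Rightarrow> 'v \<Rightarrow> 'v" (\<open>\<lbrakk>_, _\<rbrakk>\<index>\<close>)

locale lie_algebra = Module.module "class_ring :: 'k ring" L
  for L :: "('k :: field, 'v) lie_alg" (structure) +
  assumes bracket_closed:
      "x \<in> carrier L \<Longrightarrow> y \<in> carrier L \<Longrightarrow> \<lbrakk>x, y\<rbrakk> \<in> carrier L"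
    and bracket_add_left:
      "x \<in> carrier L \<Longrightarrow> y \<in> carrier L \<Longrightarrow> z \<in> carrier L \<Longrightarrow>
        \<lbrakk>x \<oplus>\<^bsub>L\<^esub> y, z\<rbrakk> = \<lbrakk>x, z\<rbrakk> \<oplus>\<^bsub>L\<^esub> \<lbrakk>y, z\<rbrakk>"
    and bracket_add_right:
      "x \<in> carrier L \<Longrightarrow> y \<in> carrier L \<Longrightarrow> z \<in> carrier L \<Longrightarrow>
        \<lbrakk>x, y \<oplus>\<^bsub>L\<^esub> z\<rbrakk> = \<lbrakk>x, y\<rbrakk> \<oplus>\<^bsub>L\<^esub> \<lbrakk>x, z\<rbrakk>"
    and bracket_smult_left:
      "x \<in> carrier L \<Longrightarrow> y \<in> carrier L \<Longrightarrow> \<lbrakk>a \<odot>\<^bsub>L\<^esub> x, y\<rbrakk> = a \<odot>\<^bsub>L\<^esub> \<lbrakk>x, y\<rbrakk>"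
    and bracket_smult_right:
      "x \<in> carrier L \<Longrightarrow> y \<in> carrier L \<Longrightarrow> \<lbrakk>x, a \<odot>\<^bsub>L\<^esub> y\<rbrakk> = a \<odot>\<^bsub>L\<^esub> \<lbrakk>x, y\<rbrakk>"
    and bracket_self: "x \<in> carrier L \<Longrightarrow> \<lbrakk>x, x\<rbrakk> = \<zero>\<^bsub>L\<^esub>"
    and jacobi:
      "x \<in> carrier L \<Longrightarrow> y \<in> carrier L \<Longrightarrow> z \<in> carrier L \<Longrightarrow>
        \<lbrakk>x, \<lbrakk>y, z\<rbrakk>\<rbrakk> \<oplus>\<^bsub>L\<^esub> \<lbrakk>y, \<lbrakk>z, x\<rbrakk>\<rbrakk> \<oplus>\<^bsub>L\<^esub> \<lbrakk>z, \<lbrakk>x, y\<rbrakk>\<rbrakk> = \<zero>\<^bsub>L\<^esub>"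

text \<open>\<open>ad_coeff L x y r k\<close> is the coefficient of \<open>\<lambda>\<^sup>k\<close> in \<open>ad(\<lambda>x + y)\<^sup>r (x)\<close>, computed in
  \<open>L \<otimes> k[\<lambda>]\<close>. Jacobson's elements \<open>s\<^sub>i(x, y)\<close>, for \<open>0 < i < p\<close>, are given by
  \<open>\<Sum>\<^sub>i i s\<^sub>i(x, y) \<lambda>\<^sup>i\<^sup>-\<^sup>1 = ad(\<lambda>x + y)\<^sup>p\<^sup>-\<^sup>1 (x)\<close>.\<close>

primrec ad_coeff :: "('k, 'v) lie_alg \<Rightarrow> 'v \<Rightarrow> 'v \<Rightarrow> nat \<Rightarrow> nat \<Rightarrow> 'v" where
  "ad_coeff L x y 0 k = (if k = 0 then x else \<zero>\<^bsub>L\<^esub>)"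
| "ad_coeff L x y (Suc r) k =
     \<lbrakk>y, ad_coeff L x y r k\<rbrakk>\<^bsub>L\<^esub> \<oplus>\<^bsub>L\<^esub>
     (if k = 0 then \<zero>\<^bsub>L\<^esub> else \<lbrakk>x, ad_coeff L x y r (k - 1)\<rbrakk>\<^bsub>L\<^esub>)"

definition jacobson_s :: "('k :: field, 'v) lie_alg \<Rightarrow> nat \<Rightarrow> 'v \<Rightarrow> 'v \<Rightarrow> 'v" where
  "jacobson_s L i x y = inverse (of_nat i) \<odot>\<^bsub>L\<^esub> ad_coeff L x y (CHAR('k) - 1) (i - 1)"

locale restricted_lie_algebra = lie_algebra L
  for L :: "('k :: field, 'v) lie_alg" (structure) +
  fixes P :: "'v \<Rightarrow> 'v"
  assumes char_pos: "CHAR('k) > 0"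
    and pmap_closed: "x \<in> carrier L \<Longrightarrow> P x \<in> carrier L"
    and ad_pmap:
      "x \<in> carrier L \<Longrightarrow> y \<in> carrier L \<Longrightarrow> \<lbrakk>P x, y\<rbrakk> = ((\<lambda>z. \<lbrakk>x, z\<rbrakk>) ^^ CHAR('k)) y"
    and pmap_smult: "x \<in> carrier L \<Longrightarrow> P (a \<odot>\<^bsub>L\<^esub> x) = (a ^ CHAR('k)) \<odot>\<^bsub>L\<^esub> P x"
    and pmap_add:
      "x \<in> carrier L \<Longrightarrow> y \<in> carrier L \<Longrightarrow>
        P (x \<oplus>\<^bsub>L\<^esub> y) = P x \<oplus>\<^bsub>L\<^esub> P y \<oplus>\<^bsub>L\<^esub> (\<Oplus>\<^bsub>L\<^esub>i\<in>{1..<CHAR('k)}. jacobson_s L i x y)"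

definition p_nilpotent :: "('k, 'v) lie_alg \<Rightarrow> ('v \<Rightarrow> 'v) \<Rightarrow> 'v \<Rightarrow> bool" where
  "p_nilpotent L P x \<longleftrightarrow> (\<exists>N. \<forall>i\<ge>N. (P ^^ i) x = \<zero>\<^bsub>L\<^esub>)"


section \<open>Truncated current algebras\<close>

text \<open>\<open>L \<otimes> k[t]/(t\<^sup>m\<^sup>+\<^sup>1)\<close>: an element \<open>\<Sum>\<^sub>i\<^sub>\<le>\<^sub>m x\<^sub>i t\<^sup>i\<close> is represented by its family of coefficients
  \<open>(x\<^sub>0, \<dots>, x\<^sub>m)\<close>.\<close>

definition current_algebra :: "nat \<Rightarrow> ('k, 'v) lie_alg \<Rightarrow> ('k, nat \<Rightarrow> 'v) lie_alg" where
  "current_algebra m L = \<lparr>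
     carrier = {..m} \<rightarrow>\<^sub>E carrier L,
     mult = undefined, one = undefined,
     zero = (\<lambda>k\<in>{..m}. \<zero>\<^bsub>L\<^esub>),
     add = (\<lambda>x y. \<lambda>k\<in>{..m}. x k \<oplus>\<^bsub>L\<^esub> y k),
     smult = (\<lambda>a x. \<lambda>k\<in>{..m}. a \<odot>\<^bsub>L\<^esub> x k),
     lie_bracket = (\<lambda>x y. \<lambda>k\<in>{..m}. \<Oplus>\<^bsub>L\<^esub>i\<in>{..k}. \<lbrakk>x i, y (k - i)\<rbrakk>\<^bsub>L\<^esub>)\<rparr>"

text \<open>The element \<open>x t\<^sup>i\<close>; it is zero for \<open>i > m\<close>.\<close>

definition tmonom :: "nat \<Rightarrow> ('k, 'v) lie_alg \<Rightarrow> 'v \<Rightarrow> nat \<Rightarrow> (nat \<Rightarrow> 'v)" where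
  "tmonom m L x i = (\<lambda>k\<in>{..m}. if k = i then x else \<zero>\<^bsub>L\<^esub>)"


section \<open>Linear algebraic groups\<close>

text \<open>Affine algebraic groups over an algebraically closed field are taken as Zariski closed
  subgroups of some \<open>GL\<^sub>n\<close>.\<close>

definition GL :: "nat \<Rightarrow> 'a :: field mat monoid" where
  "GL n = units_of (ring_mat TYPE('a) n ())"

text \<open>Polynomials in the variables \<open>x\<^sub>i\<^sub>j\<close>, \<open>i, j < n\<close>.\<close>

type_synonym 'a mpoly = "((nat \<times> nat) \<Rightarrow>\<^sub>0 nat) \<Rightarrow>\<^sub>0 'a"

definition mat_polys :: "nat \<Rightarrow> 'a :: zero mpoly set" where
  "mat_polys n = {f. \<forall>u \<in> Poly_Mapping.keys f. Poly_Mapping.keys u \<subseteq> {..<n} \<times> {..<n}}"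

definition mpoly_insert ::
  "('a :: zero \<Rightarrow> 'b :: comm_semiring_1) \<Rightarrow> (nat \<times> nat \<Rightarrow> 'b) \<Rightarrow> 'a mpoly \<Rightarrow> 'b" where
  "mpoly_insert c v f = (\<Sum>u\<in>Poly_Mapping.keys f.
     c (Poly_Mapping.lookup f u) * (\<Prod>x\<in>Poly_Mapping.keys u. v x ^ Poly_Mapping.lookup u x))"

definition mat_eval :: "'a :: comm_semiring_1 mpoly \<Rightarrow> 'a mat \<Rightarrow> 'a" where
  "mat_eval f A = mpoly_insert (\<lambda>c. c) (\<lambda>ij. A $$ ij) f"

text \<open>The differential of \<open>f\<close> at \<open>1\<close> in direction \<open>X\<close>, i.e. the coefficient of \<open>s\<close> in \<open>f(1 + sX)\<close>.\<close>

definition mat_diff :: "nat \<Rightarrow> 'a :: field mpoly \<Rightarrow> 'a mat \<Rightarrow> 'a" where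
  "mat_diff n f X = poly.coeff (mpoly_insert (\<lambda>c. [:c:]) (\<lambda>ij. [:1\<^sub>m n $$ ij, X $$ ij:]) f) 1"

definition zariski_closed :: "nat \<Rightarrow> 'a :: field mat set \<Rightarrow> bool" where
  "zariski_closed n S \<longleftrightarrow>
     (\<exists>F \<subseteq> mat_polys n. S = {A \<in> carrier (GL n). \<forall>f\<in>F. mat_eval f A = 0})"

definition zariski_connected :: "nat \<Rightarrow> 'a :: field mat set \<Rightarrow> bool" where
  "zariski_connected n S \<longleftrightarrow>
     \<not> (\<exists>A B. zariski_closed n A \<and> zariski_closed n B \<and> A \<union> B = S \<and> A \<inter> B = {} \<and> A \<noteq> {} \<and> B \<noteq> {})"

definition algebraic_group :: "nat \<Rightarrow> 'a :: field mat set \<Rightarrow> bool" where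
  "algebraic_group n G \<longleftrightarrow> subgroup G (GL n) \<and> zariski_closed n G"

text \<open>The Lie algebra as the tangent space of \<open>G\<close> at \<open>1\<close> inside \<open>\<gg>\<ll>\<^sub>n\<close>. Its \<open>p\<close>-map is the \<open>p\<close>-th
  power of matrices.\<close>

definition Lie :: "nat \<Rightarrow> 'a :: field mat set \<Rightarrow> ('a, 'a mat) lie_alg" where
  "Lie n G = \<lparr>
     carrier = {X \<in> carrier_mat n n.
       \<forall>f \<in> mat_polys n. (\<forall>A\<in>G. mat_eval f A = 0) \<longrightarrow> mat_diff n f X = 0},
     mult = undefined, one = undefined,
     zero = 0\<^sub>m n n,
     add = (+),
     smult = (\<cdot>\<^sub>m),
     lie_bracket = (\<lambda>X Y. X * Y - Y * X)\<rparr>"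

definition Lie_pmap :: "'a :: field mat \<Rightarrow> 'a mat" where
  "Lie_pmap X = X ^\<^sub>m CHAR('a)"

definition Ad :: "nat \<Rightarrow> 'a :: field mat \<Rightarrow> 'a mat \<Rightarrow> 'a mat" where
  "Ad n g X = g * X * inv\<^bsub>GL n\<^esub> g"

definition unipotent :: "nat \<Rightarrow> 'a :: field mat set \<Rightarrow> bool" where
  "unipotent n U \<longleftrightarrow> (\<forall>A\<in>U. \<exists>k. (A - 1\<^sub>m n) ^\<^sub>m k = 0\<^sub>m n n)"

text \<open>Reductive means that the unipotent radical, the largest connected closed normal unipotent
  subgroup, is trivial.\<close>

definition connected_reductive :: "nat \<Rightarrow> 'a :: field mat set \<Rightarrow> bool" where
  "connected_reductive n G \<longleftrightarrow>
     algebraic_group n G \<and> zariski_connected n G \<and>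
     (\<forall>U. algebraic_group n U \<and> zariski_connected n U \<and> unipotent n U \<and>
        U \<lhd> (GL n)\<lparr>carrier := G\<rparr> \<longrightarrow> U = {1\<^sub>m n})"


section \<open>Tori, roots and coroots\<close>

text \<open>A torus is a connected diagonalizable group.\<close>

definition torus :: "nat \<Rightarrow> 'a :: field mat set \<Rightarrow> bool" where
  "torus n T \<longleftrightarrow> algebraic_group n T \<and> zariski_connected n T \<and>
     (\<exists>g \<in> carrier (GL n). \<forall>t\<in>T. diagonal_mat (g * t * inv\<^bsub>GL n\<^esub> g))"

definition maximal_torus :: "nat \<Rightarrow> 'a :: field mat set \<Rightarrow> 'a mat set \<Rightarrow> bool" where
  "maximal_torus n G T \<longleftrightarrow> torus n T \<and> T \<subseteq> G \<and>
     (\<forall>T'. torus n T' \<and> T' \<subseteq> G \<and> T \<subseteq> T' \<longrightarrow> T' = T)"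

text \<open>Characters \<open>T \<rightarrow> k\<^sup>\<times>\<close> and cocharacters \<open>k\<^sup>\<times> \<rightarrow> T\<close> are morphisms of algebraic groups. Regular
  functions on \<open>T\<close> are the restrictions of elements of \<open>k[x\<^sub>i\<^sub>j, det\<^sup>-\<^sup>1]\<close>, those on \<open>k\<^sup>\<times>\<close> are the
  Laurent polynomials.\<close>

definition characters :: "nat \<Rightarrow> 'a :: field mat set \<Rightarrow> ('a mat \<Rightarrow> 'a) set" where
  "characters n T = {\<chi> \<in> T \<rightarrow>\<^sub>E (UNIV - {0}).
     (\<forall>s\<in>T. \<forall>t\<in>T. \<chi> (s * t) = \<chi> s * \<chi> t) \<and>
     (\<exists>f \<in> mat_polys n. \<exists>r. \<forall>t\<in>T. \<chi> t = mat_eval f t / det t ^ r)}"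

definition cocharacters :: "nat \<Rightarrow> 'a :: field mat set \<Rightarrow> ('a \<Rightarrow> 'a mat) monoid" where
  "cocharacters n T = \<lparr>
     carrier = {\<gamma> \<in> (UNIV - {0}) \<rightarrow>\<^sub>E T.
       (\<forall>z w. z \<noteq> 0 \<longrightarrow> w \<noteq> 0 \<longrightarrow> \<gamma> (z * w) = \<gamma> z * \<gamma> w) \<and>
       (\<forall>i<n. \<forall>j<n. \<exists>f r. \<forall>z. z \<noteq> 0 \<longrightarrow> \<gamma> z $$ (i, j) = poly f z / z ^ r)},
     mult = (\<lambda>\<gamma> \<delta>. \<lambda>z\<in>UNIV - {0}. \<gamma> z * \<delta> z),
     one = (\<lambda>z\<in>UNIV - {0}. 1\<^sub>m n)\<rparr>"

definition roots :: "nat \<Rightarrow> 'a :: field mat set \<Rightarrow> 'a mat set \<Rightarrow> ('a mat \<Rightarrow> 'a) set" where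
  "roots n G T = {\<alpha> \<in> characters n T. (\<exists>t\<in>T. \<alpha> t \<noteq> 1) \<and>
     (\<exists>X \<in> carrier (Lie n G). X \<noteq> 0\<^sub>m n n \<and> (\<forall>t\<in>T. Ad n t X = \<alpha> t \<cdot>\<^sub>m X))}"

text \<open>\<open>\<gamma>\<close> is the coroot \<open>\<alpha>\<^sup>\<or>\<close>: \<open>\<langle>\<alpha>, \<gamma>\<rangle> = 2\<close>, and the reflection \<open>t \<mapsto> t \<gamma>(\<alpha>(t))\<^sup>-\<^sup>1\<close> of \<open>T\<close>, which
  acts on characters by \<open>\<chi> \<mapsto> \<chi> - \<langle>\<chi>, \<gamma>\<rangle>\<alpha>\<close>, belongs to the Weyl group. As the Weyl group is
  finite, it contains at most one reflection negating \<open>\<alpha>\<close>, so this determines \<open>\<gamma>\<close>.\<close>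

definition is_coroot ::
  "nat \<Rightarrow> 'a :: field mat set \<Rightarrow> 'a mat set \<Rightarrow> ('a mat \<Rightarrow> 'a) \<Rightarrow> ('a \<Rightarrow> 'a mat) \<Rightarrow> bool" where
  "is_coroot n G T \<alpha> \<gamma> \<longleftrightarrow> \<gamma> \<in> carrier (cocharacters n T) \<and>
     (\<forall>z. z \<noteq> 0 \<longrightarrow> \<alpha> (\<gamma> z) = z ^ 2) \<and>
     (\<exists>w\<in>G. \<forall>t\<in>T. w * t * inv\<^bsub>GL n\<^esub> w = t * \<gamma> (inverse (\<alpha> t)))"

definition coroots :: "nat \<Rightarrow> 'a :: field mat set \<Rightarrow> 'a mat set \<Rightarrow> ('a \<Rightarrow> 'a mat) set" where
  "coroots n G T = {\<gamma>. \<exists>\<alpha> \<in> roots n G T. is_coroot n G T \<alpha> \<gamma>}"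

text \<open>A semisimple group is simply connected if the coroots generate the cocharacter lattice. The
  choice of the maximal torus is immaterial, since all of them are conjugate.\<close>

definition simply_connected :: "nat \<Rightarrow> 'a :: field mat set \<Rightarrow> bool" where
  "simply_connected n G \<longleftrightarrow>
     (\<exists>T. maximal_torus n G T \<and>
       generate (cocharacters n T) (coroots n G T) = carrier (cocharacters n T))"

text \<open>\<open>char_comb \<Delta> c t\<close> is the value at \<open>t\<close> of the character \<open>\<Sum>\<^sub>\<beta>\<^sub>\<in>\<^sub>\<Delta> c\<^sub>\<beta> \<beta>\<close>, written additively.\<close>

definition char_comb ::
  "('a mat \<Rightarrow> 'a :: field) set \<Rightarrow> (('a mat \<Rightarrow> 'a) \<Rightarrow> int) \<Rightarrow> 'a mat \<Rightarrow> 'a" where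
  "char_comb \<Delta> c t = (\<Prod>\<beta>\<in>\<Delta>. \<beta> t powi c \<beta>)"

definition root_base ::
  "nat \<Rightarrow> 'a :: field mat set \<Rightarrow> 'a mat set \<Rightarrow> ('a mat \<Rightarrow> 'a) set \<Rightarrow> bool" where
  "root_base n G T \<Delta> \<longleftrightarrow> finite \<Delta> \<and> \<Delta> \<subseteq> roots n G T \<and>
     (\<forall>c. (\<forall>t\<in>T. char_comb \<Delta> c t = 1) \<longrightarrow> (\<forall>\<beta>\<in>\<Delta>. c \<beta> = 0)) \<and>
     (\<forall>\<alpha> \<in> roots n G T. \<exists>c. (\<forall>t\<in>T. \<alpha> t = char_comb \<Delta> c t) \<and>
        ((\<forall>\<beta>\<in>\<Delta>. c \<beta> \<ge> 0) \<or> (\<forall>\<beta>\<in>\<Delta>. c \<beta> \<le> 0)))"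

text \<open>A prime is good if it divides no nonzero coefficient of a root expressed in the simple roots;
  again the choices of torus and base are immaterial.\<close>

definition good_prime :: "nat \<Rightarrow> nat \<Rightarrow> 'a :: field mat set \<Rightarrow> bool" where
  "good_prime p n G \<longleftrightarrow> prime p \<and>
     (\<exists>T \<Delta>. maximal_torus n G T \<and> root_base n G T \<Delta> \<and>
       (\<forall>\<alpha> \<in> roots n G T. \<forall>c. (\<forall>t\<in>T. \<alpha> t = char_comb \<Delta> c t) \<longrightarrow>
          (\<forall>\<beta>\<in>\<Delta>. c \<beta> \<noteq> 0 \<longrightarrow> \<not> int p dvd c \<beta>)))"


section \<open>Standard reductive groups\<close>

definition nondegenerate_invariant_form ::
  "nat \<Rightarrow> 'a :: field mat set \<Rightarrow> ('a mat \<Rightarrow> 'a mat \<Rightarrow> 'a) \<Rightarrow> bool" where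
  "nondegenerate_invariant_form n G \<kappa> \<longleftrightarrow> (let \<gg> = carrier (Lie n G) in
     (\<forall>X\<in>\<gg>. \<forall>Y\<in>\<gg>. \<forall>Z\<in>\<gg>. \<kappa> (X + Y) Z = \<kappa> X Z + \<kappa> Y Z \<and> \<kappa> Z (X + Y) = \<kappa> Z X + \<kappa> Z Y) \<and>
     (\<forall>a. \<forall>X\<in>\<gg>. \<forall>Y\<in>\<gg>. \<kappa> (a \<cdot>\<^sub>m X) Y = a * \<kappa> X Y \<and> \<kappa> X (a \<cdot>\<^sub>m Y) = a * \<kappa> X Y) \<and>
     (\<forall>g\<in>G. \<forall>X\<in>\<gg>. \<forall>Y\<in>\<gg>. \<kappa> (Ad n g X) (Ad n g Y) = \<kappa> X Y) \<and>
     (\<forall>X\<in>\<gg>. (\<forall>Y\<in>\<gg>. \<kappa> X Y = 0) \<longrightarrow> X = 0\<^sub>m n n) \<and>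
     (\<forall>Y\<in>\<gg>. (\<forall>X\<in>\<gg>. \<kappa> X Y = 0) \<longrightarrow> Y = 0\<^sub>m n n))"

definition standard_reductive :: "nat \<Rightarrow> 'a :: alg_closed_field mat set \<Rightarrow> bool" where
  "standard_reductive n G \<longleftrightarrow>
     connected_reductive n G \<and>
     simply_connected n (derived (GL n) G) \<and>
     good_prime CHAR('a) n G \<and>
     (\<exists>\<kappa>. nondegenerate_invariant_form n G \<kappa>)"

end

theory Submission
  imports Defs
begin

text \<open>Write \<open>L\<close> for the Lie algebra of \<open>G\<close>, \<open>C\<close> for its truncated current algebra, \<open>P\<close> for the
  \<open>p\<close>-map of \<open>C\<close> and \<open>q\<close> for that of \<open>L\<close>. Two facts give the result.

  First, setting \<open>t = 0\<close> carries \<open>P\<close> to \<open>q\<close> (\<open>p_map_coeff_0\<close>). Hence if \<open>P\<^sup>i x\<close> vanishes, so does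
  \<open>q\<^sup>i x\<^sub>0\<close>, and conversely if \<open>q\<^sup>N x\<^sub>0 = 0\<close>, then \<open>P\<^sup>N x\<close> lies in the ideal \<open>t C\<close>.

  Secondly, \<open>P\<close> maps \<open>t\<^sup>j C\<close> into \<open>t\<^sup>p\<^sup>j C\<close> (\<open>p_map_in_F\<close>): it does so on monomials, and the
  correction terms \<open>s\<^sub>i(x, y)\<close> in Jacobson's formula for \<open>P(x + y)\<close> are combinations of \<open>p\<close>-fold
  brackets of \<open>x\<close> and \<open>y\<close>. So each application of \<open>P\<close> to an element of \<open>t C\<close> raises its
  \<open>t\<close>-adic order, and since \<open>t\<^sup>m\<^sup>+\<^sup>1 = 0\<close>, every element of \<open>t C\<close> is nilpotent.\<close>

section \<open>The t-adic filtration of a truncated current algebra\<close>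

text \<open>The ideal \<open>t\<^sup>j C\<close>.\<close>

definition t_filtration :: "nat \<Rightarrow> ('k, 'v) lie_alg \<Rightarrow> nat \<Rightarrow> (nat \<Rightarrow> 'v) set" where
  "t_filtration m L j =
     {x \<in> carrier (current_algebra m L). \<forall>k\<le>m. k < j \<longrightarrow> x k = \<zero>\<^bsub>L\<^esub>}"

text \<open>The vanishing of \<open>\<lbrakk>0, y\<rbrakk>\<close> and \<open>\<lbrakk>y, 0\<rbrakk>\<close> in \<open>L\<close> is an assumption because it does not follow from
  the axioms for \<open>C\<close>: if such a bracket lies outside \<open>carrier L\<close>, then the sums that define the bracket of
  \<open>C\<close> have unspecified values and say nothing about it.\<close>

locale current_p_map =
  restricted_lie_algebra "current_algebra m L" P
  for m :: nat and L :: "('k :: field, 'v) lie_alg" and P +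
  fixes q :: "'v \<Rightarrow> 'v"
  assumes bracket_zero_left: "y \<in> carrier L \<Longrightarrow> \<lbrakk>\<zero>\<^bsub>L\<^esub>, y\<rbrakk>\<^bsub>L\<^esub> = \<zero>\<^bsub>L\<^esub>"
    and bracket_zero_right: "y \<in> carrier L \<Longrightarrow> \<lbrakk>y, \<zero>\<^bsub>L\<^esub>\<rbrakk>\<^bsub>L\<^esub> = \<zero>\<^bsub>L\<^esub>"
    and p_map_tmonom: "x \<in> carrier L \<Longrightarrow> i \<le> m \<Longrightarrow>
      P (tmonom m L x i) = tmonom m L (q x) (CHAR('k) * i)"
begin

abbreviation C :: "('k, nat \<Rightarrow> 'v) lie_alg" where "C \<equiv> current_algebra m L"
abbreviation F :: "nat \<Rightarrow> (nat \<Rightarrow> 'v) set" where "F \<equiv> t_filtration m L"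

lemma carrier_current: "carrier C = {..m} \<rightarrow>\<^sub>E carrier L"
  and zero_current: "\<zero>\<^bsub>C\<^esub> = (\<lambda>k\<in>{..m}. \<zero>\<^bsub>L\<^esub>)"
  and add_current: "x \<oplus>\<^bsub>C\<^esub> y = (\<lambda>k\<in>{..m}. x k \<oplus>\<^bsub>L\<^esub> y k)"
  and smult_current: "a \<odot>\<^bsub>C\<^esub> x = (\<lambda>k\<in>{..m}. a \<odot>\<^bsub>L\<^esub> x k)"
  and bracket_current:
    "\<lbrakk>x, y\<rbrakk>\<^bsub>C\<^esub> = (\<lambda>k\<in>{..m}. \<Oplus>\<^bsub>L\<^esub>i\<in>{..k}. \<lbrakk>x i, y (k - i)\<rbrakk>\<^bsub>L\<^esub>)"
  by (simp_all add: current_algebra_def)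

lemma coeff_closed: "x \<in> carrier C \<Longrightarrow> k \<le> m \<Longrightarrow> x k \<in> carrier L"
  by (auto simp: carrier_current)

lemma current_eqI:
  assumes "x \<in> carrier C" "y \<in> carrier C" "\<And>k. k \<le> m \<Longrightarrow> x k = y k"
  shows "x = y"
  using assms unfolding carrier_current by (intro PiE_ext) auto

lemma zero_closed_L: "\<zero>\<^bsub>L\<^esub> \<in> carrier L"
  using coeff_closed[OF zero_closed, of 0] by (simp add: zero_current)

lemma tmonom_closed: "x \<in> carrier L \<Longrightarrow> tmonom m L x i \<in> carrier C"
  by (auto simp: tmonom_def carrier_current zero_closed_L)

text \<open>The additive laws of \<open>L\<close> are those of \<open>C\<close> read off at constant terms.\<close>

lemma abelian_monoid_L: "abelian_monoid L"
proof (rule abelian_monoidI)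
  fix x y z assume x: "x \<in> carrier L" and y: "y \<in> carrier L" and z: "z \<in> carrier L"
  note mon = tmonom_closed[OF x, of 0] tmonom_closed[OF y, of 0] tmonom_closed[OF z, of 0]
  show "x \<oplus>\<^bsub>L\<^esub> y \<in> carrier L"
    using coeff_closed[OF a_closed[OF mon(1,2)], of 0] by (simp add: add_current tmonom_def)
  show "(x \<oplus>\<^bsub>L\<^esub> y) \<oplus>\<^bsub>L\<^esub> z = x \<oplus>\<^bsub>L\<^esub> (y \<oplus>\<^bsub>L\<^esub> z)"
    using fun_cong[OF a_assoc[OF mon], of 0] by (simp add: add_current tmonom_def)
  show "\<zero>\<^bsub>L\<^esub> \<oplus>\<^bsub>L\<^esub> x = x"
    using fun_cong[OF l_zero[OF mon(1)], of 0] by (simp add: add_current zero_current tmonom_def)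
  show "x \<oplus>\<^bsub>L\<^esub> y = y \<oplus>\<^bsub>L\<^esub> x"
    using fun_cong[OF a_comm[OF mon(1,2)], of 0] by (simp add: add_current tmonom_def)
qed (rule zero_closed_L)

sublocale coeff: abelian_monoid L
  by (rule abelian_monoid_L)

lemma smult_zero_L: "a \<odot>\<^bsub>L\<^esub> \<zero>\<^bsub>L\<^esub> = \<zero>\<^bsub>L\<^esub>"
proof -
  have "a \<in> carrier class_ring"
    by simp
  from fun_cong[OF smult_r_null[OF this], of 0] show ?thesis
    by (simp add: smult_current zero_current)
qed

lemma finsum_current:
  assumes "finite A" "f \<in> A \<rightarrow> carrier C" "k \<le> m"
  shows "(\<Oplus>\<^bsub>C\<^esub>i\<in>A. f i) k = (\<Oplus>\<^bsub>L\<^esub>i\<in>A. f i k)"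
  using assms
proof (induction A rule: finite_induct)
  case empty
  then show ?case by (simp add: zero_current)
next
  case (insert a A)
  then have f: "f \<in> A \<rightarrow> carrier C" "f a \<in> carrier C" by auto
  have "(\<lambda>i. f i k) \<in> A \<rightarrow> carrier L" "f a k \<in> carrier L"
    using f insert.prems(2) by (auto intro!: coeff_closed)
  then show ?case using insert f by (simp add: add_current)
qed

lemma F_carrier: "x \<in> F j \<Longrightarrow> x \<in> carrier C"
  by (simp add: t_filtration_def)

lemma F_coeff: "x \<in> F j \<Longrightarrow> k \<le> m \<Longrightarrow> k < j \<Longrightarrow> x k = \<zero>\<^bsub>L\<^esub>"
  by (simp add: t_filtration_def)

lemma F_0: "F 0 = carrier C"
  by (auto simp: t_filtration_def)

lemma F_antimono: "i \<le> j \<Longrightarrow> F j \<subseteq> F i"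
  by (auto simp: t_filtration_def)

lemma F_eventually_zero: "m < j \<Longrightarrow> F j = {\<zero>\<^bsub>C\<^esub>}"
  by (auto simp: t_filtration_def zero_current intro!: current_eqI zero_closed_L)
     (auto simp: carrier_current)

lemma zero_in_F: "\<zero>\<^bsub>C\<^esub> \<in> F j"
  using zero_closed by (auto simp: t_filtration_def zero_current)

lemma add_in_F: "x \<in> F j \<Longrightarrow> y \<in> F j \<Longrightarrow> x \<oplus>\<^bsub>C\<^esub> y \<in> F j"
  using a_closed[of x y] by (auto simp: t_filtration_def add_current)

lemma smult_in_F: "x \<in> F j \<Longrightarrow> a \<odot>\<^bsub>C\<^esub> x \<in> F j"
  using smult_closed[of a x]
  by (auto simp: t_filtration_def smult_current smult_zero_L)

lemma finsum_in_F:
  assumes "finite A" "\<And>a. a \<in> A \<Longrightarrow> f a \<in> F j"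
  shows "(\<Oplus>\<^bsub>C\<^esub>a\<in>A. f a) \<in> F j"
  using assms
proof (induction A rule: finite_induct)
  case (insert a A)
  then have "f \<in> A \<rightarrow> carrier C" "f a \<in> carrier C"
    by (auto intro: F_carrier)
  with insert show ?case by (simp add: add_in_F)
qed (simp add: zero_in_F)

lemma tmonom_in_F: "x \<in> carrier L \<Longrightarrow> j \<le> i \<Longrightarrow> tmonom m L x i \<in> F j"
  using tmonom_closed[of x i] by (auto simp: t_filtration_def tmonom_def)

text \<open>In \<open>\<Sum>\<^sub>l \<lbrakk>x\<^sub>l, y\<^sub>k\<^sub>-\<^sub>l\<rbrakk>\<close> with \<open>k < i + j\<close>, every term has \<open>l < i\<close> or \<open>k - l < j\<close>.\<close>

lemma bracket_in_F:
  assumes x: "x \<in> F i" and y: "y \<in> F j"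
  shows "\<lbrakk>x, y\<rbrakk>\<^bsub>C\<^esub> \<in> F (i + j)"
proof -
  have "\<lbrakk>x l, y (k - l)\<rbrakk>\<^bsub>L\<^esub> = \<zero>\<^bsub>L\<^esub>" if "k \<le> m" "k < i + j" "l \<le> k" for k l
  proof (cases "l < i")
    case True
    then have "x l = \<zero>\<^bsub>L\<^esub>" using F_coeff[OF x, of l] that by simp
    then show ?thesis using coeff_closed[OF F_carrier[OF y], of "k - l"] that
      by (simp add: bracket_zero_left)
  next
    case False
    then have "y (k - l) = \<zero>\<^bsub>L\<^esub>" using F_coeff[OF y, of "k - l"] that by simp
    then show ?thesis using coeff_closed[OF F_carrier[OF x], of l] that
      by (simp add: bracket_zero_right)
  qed
  then have "(\<Oplus>\<^bsub>L\<^esub>l\<in>{..k}. \<lbrakk>x l, y (k - l)\<rbrakk>\<^bsub>L\<^esub>) = \<zero>\<^bsub>L\<^esub>" if "k \<le> m" "k < i + j" for k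
    using that by (intro coeff.add.finprod_one_eqI) auto
  then show ?thesis
    using bracket_closed[OF F_carrier[OF x] F_carrier[OF y]]
    by (auto simp: t_filtration_def bracket_current)
qed

section \<open>The p-map and the filtration\<close>

text \<open>The coefficients of \<open>ad(\<lambda>x + y)\<^sup>r (x)\<close> are sums of brackets with \<open>r + 1\<close> factors, so those in
  Jacobson's elements, where \<open>r = p - 1\<close>, have \<open>p\<close> factors.\<close>

lemma ad_coeff_in_F:
  assumes x: "x \<in> F j" and y: "y \<in> F j"
  shows "ad_coeff C x y r k \<in> F (Suc r * j)"
proof (induction r arbitrary: k)
  case 0
  then show ?case using x by (simp add: zero_in_F)
next
  case (Suc r)
  show ?case
    using bracket_in_F[OF y Suc.IH, of k] bracket_in_F[OF x Suc.IH, of "k - 1"]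
    by (simp add: add_in_F zero_in_F)
qed

lemma jacobson_s_in_F:
  assumes "x \<in> F j" "y \<in> F j"
  shows "jacobson_s C i x y \<in> F (CHAR('k) * j)"
  using smult_in_F[OF ad_coeff_in_F[OF assms], of _ "CHAR('k) - 1"] char_pos
  by (simp add: jacobson_s_def)

text \<open>Modulo the ideal \<open>t C\<close>, in which \<open>y\<close> lies, \<open>ad(\<lambda>x + y)\<^sup>r (x)\<close> is \<open>\<lambda>\<^sup>r ad(x)\<^sup>r (x)\<close>, and this is zero
  as \<open>\<lbrakk>x, x\<rbrakk> = 0\<close>. Hence Jacobson's elements do not contribute to the constant term of
  \<open>P(x + y)\<close>.\<close>

lemma ad_coeff_in_F_1:
  assumes x: "x \<in> carrier C" and y: "y \<in> F 1"
  shows "ad_coeff C x y (Suc r) k \<in> F 1"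
proof (induction r arbitrary: k)
  case 0
  have "\<lbrakk>y, x\<rbrakk>\<^bsub>C\<^esub> \<in> F 1" "\<lbrakk>y, \<zero>\<^bsub>C\<^esub>\<rbrakk>\<^bsub>C\<^esub> \<in> F 1" "\<lbrakk>x, \<zero>\<^bsub>C\<^esub>\<rbrakk>\<^bsub>C\<^esub> \<in> F 1"
    using bracket_in_F[OF y, of x 0] bracket_in_F[OF y, of "\<zero>\<^bsub>C\<^esub>" 0]
      bracket_in_F[of x 0 "\<zero>\<^bsub>C\<^esub>" 1] x zero_in_F by (simp_all add: F_0)
  moreover have "\<lbrakk>x, x\<rbrakk>\<^bsub>C\<^esub> \<in> F 1"
    using bracket_self[OF x] zero_in_F by simp
  ultimately show ?case
    by (auto intro!: add_in_F zero_in_F)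
next
  case (Suc r)
  have "\<lbrakk>y, ad_coeff C x y (Suc r) k\<rbrakk>\<^bsub>C\<^esub> \<in> F 1"
    using bracket_in_F[OF y Suc.IH, of k] F_antimono[of 1 "1 + 1"] by auto
  moreover have "\<lbrakk>x, ad_coeff C x y (Suc r) (k - 1)\<rbrakk>\<^bsub>C\<^esub> \<in> F 1"
    using bracket_in_F[of x 0, OF _ Suc.IH] x by (simp add: F_0 del: ad_coeff.simps)
  ultimately show ?case
    by (subst ad_coeff.simps(2)) (auto intro!: add_in_F zero_in_F simp del: ad_coeff.simps)
qed

lemma jacobson_s_in_F_1:
  assumes "x \<in> carrier C" "y \<in> F 1" "CHAR('k) > 1"
  shows "jacobson_s C i x y \<in> F 1"
  using smult_in_F[OF ad_coeff_in_F_1[OF assms(1,2), of "CHAR('k) - 2"]] assms(3)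
  by (simp add: jacobson_s_def numeral_2_eq_2 Suc_diff_Suc del: ad_coeff.simps)

lemma p_map_zero: "P \<zero>\<^bsub>C\<^esub> = \<zero>\<^bsub>C\<^esub>"
proof -
  have "0 \<odot>\<^bsub>C\<^esub> x = \<zero>\<^bsub>C\<^esub>" if "x \<in> carrier C" for x
    using smult_l_null[OF that] by simp
  then show ?thesis
    using pmap_smult[OF zero_closed, of 0] pmap_closed[OF zero_closed] zero_closed char_pos
    by (simp add: zero_power)
qed

lemma q_closed: "x \<in> carrier L \<Longrightarrow> q x \<in> carrier L"
  using coeff_closed[OF pmap_closed[OF tmonom_closed[of x 0]], of 0] p_map_tmonom[of x 0]
  by (simp add: tmonom_def)

lemma split_leading_term:
  assumes x: "x \<in> F j" and j: "j \<le> m"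
  obtains y where "y \<in> F (Suc j)" "x = tmonom m L (x j) j \<oplus>\<^bsub>C\<^esub> y"
proof
  let ?y = "\<lambda>k\<in>{..m}. if k = j then \<zero>\<^bsub>L\<^esub> else x k"
  have y: "?y \<in> carrier C"
    using coeff_closed[OF F_carrier[OF x]] by (auto simp: carrier_current)
  then show "?y \<in> F (Suc j)"
    using F_coeff[OF x] by (auto simp: t_filtration_def)
  show "x = tmonom m L (x j) j \<oplus>\<^bsub>C\<^esub> ?y"
  proof (rule current_eqI)
    show "tmonom m L (x j) j \<oplus>\<^bsub>C\<^esub> ?y \<in> carrier C"
      using y coeff_closed[OF F_carrier[OF x] j] by (intro a_closed tmonom_closed)
    show "x k = (tmonom m L (x j) j \<oplus>\<^bsub>C\<^esub> ?y) k" if "k \<le> m" for k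
      using that coeff_closed[OF F_carrier[OF x] that]
      by (auto simp: add_current tmonom_def)
  qed (rule F_carrier[OF x])
qed

text \<open>Downward induction on \<open>j\<close>, starting from \<open>t\<^sup>m\<^sup>+\<^sup>1 C = 0\<close>: splitting off \<open>x\<^sub>j t\<^sup>j\<close> from \<open>x\<close> leaves an
  element of \<open>t\<^sup>j\<^sup>+\<^sup>1 C\<close>, and Jacobson's formula applies to the two parts.\<close>

lemma p_map_in_F: "x \<in> F j \<Longrightarrow> P x \<in> F (CHAR('k) * j)"
proof (induction "Suc m - j" arbitrary: j x)
  case 0
  then have "x = \<zero>\<^bsub>C\<^esub>" using F_eventually_zero[of j] by auto
  then show ?case using p_map_zero zero_in_F by simp
next
  case (Suc d)
  then have j: "j \<le> m" by simp
  have xj: "x j \<in> carrier L"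
    using coeff_closed[OF F_carrier[OF Suc.prems] j] .
  obtain y where y: "y \<in> F (Suc j)" and split: "x = tmonom m L (x j) j \<oplus>\<^bsub>C\<^esub> y"
    using split_leading_term[OF Suc.prems j] .
  have mon: "tmonom m L (x j) j \<in> F j"
    using xj by (intro tmonom_in_F) auto
  have "P y \<in> F (CHAR('k) * Suc j)"
    using Suc.hyps y by (intro Suc.hyps(1)) auto
  then have "P y \<in> F (CHAR('k) * j)"
    using F_antimono[of "CHAR('k) * j" "CHAR('k) * Suc j"] by auto
  moreover have "P (tmonom m L (x j) j) \<in> F (CHAR('k) * j)"
    using xj j q_closed by (simp add: p_map_tmonom tmonom_in_F)
  moreover have "jacobson_s C i (tmonom m L (x j) j) y \<in> F (CHAR('k) * j)" for i
    using mon y F_antimono[of j "Suc j"] by (intro jacobson_s_in_F) auto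
  ultimately have "P (tmonom m L (x j) j \<oplus>\<^bsub>C\<^esub> y) \<in> F (CHAR('k) * j)"
    using pmap_add[OF F_carrier[OF mon] F_carrier[OF y]] by (simp add: add_in_F finsum_in_F)
  then show ?case using split by simp
qed

lemma char_gt_1: "CHAR('k) > 1"
  using char_pos CHAR_not_1[where ?'a = 'k] by (metis One_nat_def Suc_lessI)

section \<open>Nilpotent elements\<close>

text \<open>Write \<open>x = x\<^sub>0 + y\<close> with \<open>y \<in> t C\<close>. In Jacobson's formula for \<open>P(x\<^sub>0 + y)\<close>, both \<open>P y\<close> and the
  correction terms lie in \<open>t C\<close>, so only \<open>P x\<^sub>0 = q x\<^sub>0\<close> has a constant term.\<close>

lemma p_map_coeff_0:
  assumes x: "x \<in> carrier C"
  shows "P x 0 = q (x 0)"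
proof -
  have x0: "x 0 \<in> carrier L" using coeff_closed[OF x, of 0] by simp
  obtain y where y: "y \<in> F 1" and split: "x = tmonom m L (x 0) 0 \<oplus>\<^bsub>C\<^esub> y"
    using split_leading_term[of x 0] x by (auto simp: F_0)
  let ?s = "\<Oplus>\<^bsub>C\<^esub>i\<in>{1..<CHAR('k)}. jacobson_s C i (tmonom m L (x 0) 0) y"
  have "?s \<in> F 1"
    using jacobson_s_in_F_1[OF tmonom_closed[OF x0] y char_gt_1] by (intro finsum_in_F) auto
  moreover have "P y \<in> F 1"
    using p_map_in_F[OF y] F_antimono[of 1 "CHAR('k) * 1"] char_pos by auto
  ultimately have "?s 0 = \<zero>\<^bsub>L\<^esub>" "P y 0 = \<zero>\<^bsub>L\<^esub>"
    by (simp_all add: F_coeff)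
  moreover have "P x = P (tmonom m L (x 0) 0) \<oplus>\<^bsub>C\<^esub> P y \<oplus>\<^bsub>C\<^esub> ?s"
    using split pmap_add[OF tmonom_closed[OF x0, of 0] F_carrier[OF y]] by simp
  moreover have "P (tmonom m L (x 0) 0) 0 = q (x 0)"
    using p_map_tmonom[OF x0, of 0] by (simp add: tmonom_def)
  ultimately show ?thesis
    using q_closed[OF x0] by (simp add: add_current)
qed

lemma p_map_iterate_closed: "x \<in> carrier C \<Longrightarrow> (P ^^ i) x \<in> carrier C"
  by (induction i) (simp_all add: pmap_closed)

lemma p_map_iterate_coeff_0: "x \<in> carrier C \<Longrightarrow> (P ^^ i) x 0 = (q ^^ i) (x 0)"
  by (induction i) (simp_all add: p_map_coeff_0 p_map_iterate_closed)

lemma p_map_iterate_in_F: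
  assumes "x \<in> F 1"
  shows "(P ^^ i) x \<in> F (Suc i)"
proof (induction i)
  case (Suc i)
  have "2 * Suc i \<le> CHAR('k) * Suc i"
    using char_gt_1 by (intro mult_le_mono1) simp
  then have "Suc (Suc i) \<le> CHAR('k) * Suc i" by simp
  then show ?case
    using p_map_in_F[OF Suc.IH] F_antimono by auto
qed (use assms in simp)

theorem p_nilpotent_current_iff:
  assumes x: "x \<in> carrier C"
  shows "p_nilpotent C P x \<longleftrightarrow> p_nilpotent L q (x 0)"
proof
  assume "p_nilpotent C P x"
  then obtain N where "\<forall>i\<ge>N. (P ^^ i) x = \<zero>\<^bsub>C\<^esub>"
    by (auto simp: p_nilpotent_def)
  then have "\<forall>i\<ge>N. (q ^^ i) (x 0) = \<zero>\<^bsub>L\<^esub>"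
    using p_map_iterate_coeff_0[OF x] by (metis atMost_iff le0 restrict_apply' zero_current)
  then show "p_nilpotent L q (x 0)"
    by (auto simp: p_nilpotent_def)
next
  assume "p_nilpotent L q (x 0)"
  then obtain N where "(q ^^ N) (x 0) = \<zero>\<^bsub>L\<^esub>"
    by (auto simp: p_nilpotent_def)
  then have F1: "(P ^^ N) x \<in> F 1"
    using p_map_iterate_closed[OF x] p_map_iterate_coeff_0[OF x]
    by (auto simp: t_filtration_def)
  have "(P ^^ i) x = \<zero>\<^bsub>C\<^esub>" if "N + m \<le> i" for i
  proof -
    have "(P ^^ i) x = (P ^^ (i - N)) ((P ^^ N) x)"
      using that by (simp flip: funpow_add comp_apply[of "P ^^ _"])
    also have "\<dots> \<in> F (Suc (i - N))"
      using p_map_iterate_in_F[OF F1] .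
    finally show ?thesis
      using that F_eventually_zero[of "Suc (i - N)"] by auto
  qed
  then show "p_nilpotent C P x"
    unfolding p_nilpotent_def by blast
qed

lemma sum_tmonom:
  assumes x\<^sub>0: "x\<^sub>0 \<in> carrier L" and x: "x \<in> {1..m} \<rightarrow> carrier L"
  shows "tmonom m L x\<^sub>0 0 \<oplus>\<^bsub>C\<^esub> (\<Oplus>\<^bsub>C\<^esub>i\<in>{1..m}. tmonom m L (x i) i) =
    (\<lambda>k\<in>{..m}. if k = 0 then x\<^sub>0 else x k)" (is "?l = ?r")
proof (rule current_eqI)
  have mon: "(\<lambda>i. tmonom m L (x i) i) \<in> {1..m} \<rightarrow> carrier C"
    using x by (auto intro!: tmonom_closed)
  show "?l \<in> carrier C"
    using x\<^sub>0 mon by (intro a_closed finsum_closed tmonom_closed)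
  show "?r \<in> carrier C"
    using x\<^sub>0 x by (auto simp: carrier_current)
  show "?l k = ?r k" if k: "k \<le> m" for k
  proof -
    have "(\<Oplus>\<^bsub>C\<^esub>i\<in>{1..m}. tmonom m L (x i) i) k =
      (\<Oplus>\<^bsub>L\<^esub>i\<in>{1..m}. if k = i then x i else \<zero>\<^bsub>L\<^esub>)"
      using finsum_current[OF finite_atLeastAtMost mon k] k by (simp add: tmonom_def)
    also have "\<dots> = (if k = 0 then \<zero>\<^bsub>L\<^esub> else x k)"
    proof (cases "k = 0")
      case True
      then show ?thesis by (auto intro!: coeff.add.finprod_one_eqI)
    next
      case False
      then show ?thesis
        using coeff.add.finprod_singleton[of k "{1..m}" x] x k by simp
    qed
    finally show ?thesis
      using x\<^sub>0 x k by (auto simp: add_current tmonom_def Pi_iff)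
  qed
qed

end

theorem proposition3p4:
  fixes n m :: nat
    and G :: "'a :: alg_closed_field mat set"
    and P :: "(nat \<Rightarrow> 'a mat) \<Rightarrow> (nat \<Rightarrow> 'a mat)"
  assumes "CHAR('a) > 0"
    and "standard_reductive n G"
    and "m > 0"
    and "restricted_lie_algebra (current_algebra m (Lie n G)) P"
    and "\<And>x i. x \<in> carrier (Lie n G) \<Longrightarrow> i \<le> m \<Longrightarrow>
           P (tmonom m (Lie n G) x i) = tmonom m (Lie n G) (Lie_pmap x) (CHAR('a) * i)"
  shows "{x \<in> carrier (current_algebra m (Lie n G)).
            p_nilpotent (current_algebra m (Lie n G)) P x} =
         {tmonom m (Lie n G) x\<^sub>0 0
            \<oplus>\<^bsub>current_algebra m (Lie n G)\<^esub>
            (\<Oplus>\<^bsub>current_algebra m (Lie n G)\<^esub>i\<in>{1..m}. tmonom m (Lie n G) (x i) i) | x\<^sub>0 x.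
            x\<^sub>0 \<in> carrier (Lie n G) \<and> p_nilpotent (Lie n G) Lie_pmap x\<^sub>0 \<and>
            x \<in> {1..m} \<rightarrow> carrier (Lie n G)}"
proof -
  interpret restricted_lie_algebra "current_algebra m (Lie n G)" P
    by fact
  interpret current_p_map m "Lie n G" P Lie_pmap
    by unfold_locales (use assms(5) in \<open>auto simp: Lie_def\<close>)
  show ?thesis
  proof (intro equalityI subsetI)
    fix x assume "x \<in> {x \<in> carrier C. p_nilpotent C P x}"
    then have x: "x \<in> carrier C" and nil: "p_nilpotent (Lie n G) Lie_pmap (x 0)"
      using p_nilpotent_current_iff by auto
    have x0: "x 0 \<in> carrier (Lie n G)" and x1: "x \<in> {1..m} \<rightarrow> carrier (Lie n G)"
      using coeff_closed[OF x] by auto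
    have "x = (\<lambda>k\<in>{..m}. if k = 0 then x 0 else x k)"
      using x by (auto simp: carrier_current fun_eq_iff PiE_def extensional_def)
    also have "\<dots> = tmonom m (Lie n G) (x 0) 0 \<oplus>\<^bsub>C\<^esub> (\<Oplus>\<^bsub>C\<^esub>i\<in>{1..m}. tmonom m (Lie n G) (x i) i)"
      using sum_tmonom[OF x0 x1] by simp
    finally show "x \<in> {tmonom m (Lie n G) x\<^sub>0 0 \<oplus>\<^bsub>C\<^esub>
        (\<Oplus>\<^bsub>C\<^esub>i\<in>{1..m}. tmonom m (Lie n G) (x i) i) | x\<^sub>0 x.
        x\<^sub>0 \<in> carrier (Lie n G) \<and> p_nilpotent (Lie n G) Lie_pmap x\<^sub>0 \<and>
        x \<in> {1..m} \<rightarrow> carrier (Lie n G)}"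
      using x0 x1 nil by blast
  next
    fix y assume "y \<in> {tmonom m (Lie n G) x\<^sub>0 0 \<oplus>\<^bsub>C\<^esub>
        (\<Oplus>\<^bsub>C\<^esub>i\<in>{1..m}. tmonom m (Lie n G) (x i) i) | x\<^sub>0 x.
        x\<^sub>0 \<in> carrier (Lie n G) \<and> p_nilpotent (Lie n G) Lie_pmap x\<^sub>0 \<and>
        x \<in> {1..m} \<rightarrow> carrier (Lie n G)}"
    then obtain x\<^sub>0 x where x0: "x\<^sub>0 \<in> carrier (Lie n G)" "p_nilpotent (Lie n G) Lie_pmap x\<^sub>0"
      and x: "x \<in> {1..m} \<rightarrow> carrier (Lie n G)"
      and y: "y = (\<lambda>k\<in>{..m}. if k = 0 then x\<^sub>0 else x k)"
      using sum_tmonom by blast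
    have "y \<in> carrier C" "y 0 = x\<^sub>0"
      using x0 x by (auto simp: y carrier_current)
    then show "y \<in> {x \<in> carrier C. p_nilpotent C P x}"
      using x0 p_nilpotent_current_iff by simp
  qed
qed

end
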